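(* Fix an integer $p>1$. Let $\{x_{i+1/2}\}_{i\in\mathbb{Z}}$ be a strictly increasing sequence of real numbers (a possibly non-uniform mesh) with cells $I_i=[x_{i-1/2},x_{i+1/2})$, and let $\{\overline{v}_i\}_{i\in\mathbb{Z}}$ be given real cell averages. Let $\sum_k f_k(x)\mathbf{1}_{I_k}(x)$, with $\deg f_k\le p-1$, be the $p$-th order ENO reconstruction of these averages, and let $v^-_{i+1/2}:=f_i(x_{i+1/2})$ and $v^+_{i+1/2}:=f_{i+1}(x_{i+1/2})$ be the reconstructed left and right point-values at the interface $x_{i+1/2}$. Then at every interface $x_{i+1/2}$, $i\in\mathbb{Z}$: \[ \text{if } \overline{v}_{i+1}-\overline{v}_i\ge 0 \text{ then } v^+_{i+1/2}-v^-_{i+1/2}\ge 0;\qquad \text{if } \overline{v}_{i+1}-\overline{v}_i\le 0 \text{ then } v^+_{i+1/2}-v^-_{i+1/2}\le 0 . \] In particular, if $\overline{v}_{i+1}=\overline{v}_i$ then $v^+_{i+1/2}=v^-_{i+1/2}$. Moreover, there is a constant $\mathsf{C}_p$, depending only on $p$ and on the mesh ratios $|I_{j+1}|/|I_j|$ of neighboring grid cells (and not on the cell averages), such that, whenever $\overline{v}_{i+1}\ne\overline{v}_i$, \[ 0\le \frac{v^+_{i+1/2}-v^-_{i+1/2}}{\overline{v}_{i+1}-\overline{v}_i}\le \mathsf{C}_p . \]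
   Context: Write $|I_i|=x_{i+1/2}-x_{i-1/2}$. Typically $\overline{v}_i=\frac1{|I_i|}\int_{I_i}v(x)\,dx$ for some $v\in L^1_{\rm loc}(\mathbb{R})$. The primitive point-values are reals $V_{j+1/2}=V(x_{j+1/2})$, $j\in\mathbb{Z}$, with $V_{j+1/2}-V_{j-1/2}=|I_j|\,\overline{v}_j$ (the additive constant is irrelevant to what follows). For half-integers $k$ and integers $j\ge 0$, $V[x_k,\dots,x_{k+j}]$ denotes the usual Newton divided difference: $V[x_k]=V_k$ and $V[x_k,\dots,x_{k+j}]=\frac{V[x_{k+1},\dots,x_{k+j}]-V[x_k,\dots,x_{k+j-1}]}{x_{k+j}-x_k}$. $p$-th order ENO reconstruction in cell $I_i$: set $r_1=-\tfrac12$. For $j=1,\dots,p-1$: if $|V[x_{i+r_j-1},\dots,x_{i+r_j+j}]|<|V[x_{i+r_j},\dots,x_{i+r_j+j+1}]|$, set $r_{j+1}=r_j-1$; otherwise set $r_{j+1}=r_j$. Let $F_i$ be the polynomial of degree at most $p$ interpolating $V$ at the $p+1$ points $x_{i+r_p},x_{i+r_p+1},\dots,x_{i+r_p+p}$, and set $f_i:=F_i'$. (The offsets $r_j$ are half-integers depending on $i$ and the data.) Dependence of $\mathsf{C}_p$: at the interface $x_{i+1/2}$ the constant may depend on the ratios $|I_{j+1}|/|I_j|$ of the mesh, but on nothing else besides $p$. *)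

theory Defs
  imports Complex_Main "HOL-Computational_Algebra.Polynomial"
begin

text \<open>
  Indexing: the half-integer points are stored under the integer below them, so \<open>x j\<close> is
  $x_{j+1/2}$ and \<open>V j\<close> is $V_{j+1/2}$. In particular the cell $I_i$ is the interval from
  \<open>x (i - 1)\<close> to \<open>x i\<close>.
\<close>

definition cell_size :: "(int \<Rightarrow> real) \<Rightarrow> int \<Rightarrow> real" where
  "cell_size x i = x i - x (i - 1)"

definition is_primitive :: "(int \<Rightarrow> real) \<Rightarrow> (int \<Rightarrow> real) \<Rightarrow> (int \<Rightarrow> real) \<Rightarrow> bool" where
  "is_primitive x vbar V \<longleftrightarrow> (\<forall>j. V j - V (j - 1) = cell_size x j * vbar j)"

text \<open>\<open>divdiff x V k j\<close> is the $j$-th order divided difference on the $j+1$ points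
  \<open>x k, \<dots>, x (k + j)\<close>.\<close>

primrec divdiff :: "(int \<Rightarrow> real) \<Rightarrow> (int \<Rightarrow> real) \<Rightarrow> int \<Rightarrow> nat \<Rightarrow> real" where
  "divdiff x V k 0 = V k"
| "divdiff x V k (Suc j) =
     (divdiff x V (k + 1) j - divdiff x V k j) / (x (k + int (Suc j)) - x k)"

text \<open>
  The integer \<open>eno_offset x V i j\<close> is $r_j - \frac12$, so that $x_{i+r_j}$ is
  \<open>x (i + eno_offset x V i j)\<close>; the initial value $r_1 = -\frac12$ becomes \<open>-1\<close>.
  Index \<open>0\<close> is not used by the ENO procedure; no choice is made when passing from \<open>0\<close> to \<open>1\<close>.
\<close>

primrec eno_offset :: "(int \<Rightarrow> real) \<Rightarrow> (int \<Rightarrow> real) \<Rightarrow> int \<Rightarrow> nat \<Rightarrow> int" where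
  "eno_offset x V i 0 = - 1"
| "eno_offset x V i (Suc j) =
     (let r = eno_offset x V i j in
      if 1 \<le> j \<and> \<bar>divdiff x V (i + r - 1) (j + 1)\<bar> < \<bar>divdiff x V (i + r) (j + 1)\<bar>
      then r - 1 else r)"

definition interp_poly :: "(int \<Rightarrow> real) \<Rightarrow> (int \<Rightarrow> real) \<Rightarrow> int \<Rightarrow> nat \<Rightarrow> real poly" where
  "interp_poly x V k p =
     (THE F. degree F \<le> p \<and> (\<forall>m\<le>p. poly F (x (k + int m)) = V (k + int m)))"

definition eno_poly :: "nat \<Rightarrow> (int \<Rightarrow> real) \<Rightarrow> (int \<Rightarrow> real) \<Rightarrow> int \<Rightarrow> real poly" where
  "eno_poly p x V i = pderiv (interp_poly x V (i + eno_offset x V i p) p)"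

text \<open>The one-sided values at the interface \<open>x i\<close>, i.e. $v^-_{i+1/2}$ and $v^+_{i+1/2}$.\<close>

definition eno_left :: "nat \<Rightarrow> (int \<Rightarrow> real) \<Rightarrow> (int \<Rightarrow> real) \<Rightarrow> int \<Rightarrow> real" where
  "eno_left p x V i = poly (eno_poly p x V i) (x i)"

definition eno_right :: "nat \<Rightarrow> (int \<Rightarrow> real) \<Rightarrow> (int \<Rightarrow> real) \<Rightarrow> int \<Rightarrow> real" where
  "eno_right p x V i = poly (eno_poly p x V (i + 1)) (x i)"

text \<open>
  The mesh ratios as seen from the interface \<open>x i\<close>: entry \<open>k\<close> is
  $|I_{i+k+1}| / |I_{i+k}|$. Numbering them relative to \<open>i\<close> lets a quantity depend on the
  ratios around an interface without depending on the label \<open>i\<close> itself.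
\<close>

definition mesh_ratios :: "(int \<Rightarrow> real) \<Rightarrow> int \<Rightarrow> int \<Rightarrow> real" where
  "mesh_ratios x i k = cell_size x (i + k + 1) / cell_size x (i + k)"

text \<open>Every family of averages has a primitive, and the description in \<open>interp_poly\<close> is proper.\<close>

lemma is_primitive_exists: "\<exists>V. is_primitive x vbar V"
proof -
  define g where "g = (\<lambda>j. cell_size x j * vbar j)"
  define V where "V = (\<lambda>j. sum g {0<..j} - sum g {j<..0})"
  have "V j - V (j - 1) = g j" for j
  proof (cases "j > 0")
    case True
    then have "{0<..j} = insert j {0<..j - 1}" "{j<..0} = {}" "{j - 1<..0} = {}" by auto
    then show ?thesis by (simp add: V_def)
  next
    case False
    then have "{j - 1<..0} = insert j {j<..0}" "{0<..j} = {}" "{0<..j - 1} = {}" by auto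
    then show ?thesis by (simp add: V_def)
  qed
  then show ?thesis unfolding is_primitive_def g_def by blast
qed

lemma interp_poly_unique_exists:
  assumes "strict_mono x"
  shows "\<exists>!F. degree F \<le> p \<and> (\<forall>m\<le>p. poly F (x (k + int m)) = (V (k + int m) :: real))"
proof (rule ex_ex1I)
  have inj: "x a = x b \<longleftrightarrow> a = b" for a b using assms by (rule strict_mono_eq)
  show "\<exists>F. degree F \<le> p \<and> (\<forall>m\<le>p. poly F (x (k + int m)) = V (k + int m))"
  proof (induction p)
    case 0
    show ?case by (rule exI[of _ "[:V k:]"]) simp
  next
    case (Suc p)
    then obtain F where F: "degree F \<le> p" "\<forall>m\<le>p. poly F (x (k + int m)) = V (k + int m)"
      by blast
    define w where "w = (\<Prod>m\<le>p. [:- x (k + int m), 1:])"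
    let ?y = "k + int (Suc p)"
    have w0: "poly w (x (k + int m)) = 0" if "m \<le> p" for m
      using that by (auto simp: w_def poly_prod)
    have w1: "poly w (x ?y) \<noteq> 0" by (auto simp: w_def poly_prod inj)
    have dw: "degree w \<le> Suc p"
      unfolding w_def by (rule order.trans[OF degree_prod_sum_le]) simp_all
    define G where "G = F + smult ((V ?y - poly F (x ?y)) / poly w (x ?y)) w"
    have "degree G \<le> Suc p" unfolding G_def
      using F(1) dw by (intro degree_add_le order.trans[OF degree_smult_le]) auto
    moreover have "poly G (x (k + int m)) = V (k + int m)" if "m \<le> Suc p" for m
    proof (cases "m = Suc p")
      case True
      then show ?thesis using w1 by (simp add: G_def)
    next
      case False
      then have "m \<le> p" using that by simp
      then show ?thesis using F(2) w0 by (simp add: G_def)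
    qed
    ultimately show ?case by blast
  qed
next
  fix F G :: "real poly"
  assume F: "degree F \<le> p \<and> (\<forall>m\<le>p. poly F (x (k + int m)) = V (k + int m))"
    and G: "degree G \<le> p \<and> (\<forall>m\<le>p. poly G (x (k + int m)) = V (k + int m))"
  have inj: "inj_on (\<lambda>m. x (k + int m)) {..p}"
    using assms by (auto simp: inj_on_def strict_mono_eq)
  show "F = G"
  proof (rule ccontr)
    assume "F \<noteq> G"
    then have nz: "F - G \<noteq> 0" by simp
    have "(\<lambda>m. x (k + int m)) ` {..p} \<subseteq> {z. poly (F - G) z = 0}"
      using F G by auto
    then have "card ((\<lambda>m. x (k + int m)) ` {..p}) \<le> card {z. poly (F - G) z = 0}"
      using poly_roots_finite[OF nz] by (rule card_mono[rotated])
    also have "\<dots> \<le> degree (F - G)" by (rule card_poly_roots_bound[OF nz])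
    also have "\<dots> \<le> p" using F G by (intro degree_diff_le) auto
    finally show False using card_image[OF inj] by simp
  qed
qed

end

theory Submission
  imports Defs
begin

text \<open>
  Let \<open>F\<^sub>k\<close> be the polynomial interpolating \<open>V\<close> at the \<open>p + 1\<close> points
  \<open>x k, \<dots>, x (k + p)\<close>, and let the ENO stencils of the cells \<open>i\<close> and \<open>i + 1\<close> start at \<open>a\<close> and
  \<open>b\<close>. Then \<open>a \<le> b\<close>, and the jump at \<open>x i\<close> telescopes into the differences
  \<open>F'\<^sub>k\<^sub>+\<^sub>1 - F'\<^sub>k\<close> with \<open>a \<le> k < b\<close>. By Newton's formula \<open>F\<^sub>k\<^sub>+\<^sub>1 - F\<^sub>k\<close> is the node polynomial of
  the common points \<open>x (k + 1), \<dots>, x (k + p)\<close> times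
  \<open>divdiff x V k (p + 1) * (x (k + p + 1) - x k)\<close>. Since \<open>x i\<close> is one of the common points, the
  derivative of the node polynomial there is a product of differences of points, with the sign
  \<open>(-1) ^ (k + p - i)\<close>. Thus the jump is a combination, with nonnegative geometric weights, of the
  numbers \<open>(-1) ^ (k + p - i) * divdiff x V k (p + 1)\<close> for \<open>a \<le> k < b\<close>
  (\<open>eno_jump_eq\<close>).

  The heart of the matter is that none of these numbers has the sign opposite to that of
  \<open>vbar (i + 1) - vbar i\<close>, and that all vanish if the two averages are equal: between the two stencils the divided differences alternate. This is
  proved by induction on the order \<open>j\<close> (\<open>signed_divdiff_bounds\<close>). For \<open>j = 1\<close> the only index is
  \<open>k = i - 1\<close>, and the divided difference of order two is a positive multiple of
  \<open>vbar (i + 1) - vbar i\<close>. When the order grows, a signed divided difference becomes the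
  sum of two neighbouring ones over a positive length. Both are already under control in
  the interior of the range. At the ends of the range one of them may be uncontrolled, but this
  happens only if the ENO procedure compared the two and found the uncontrolled one not to be
  the larger in absolute value, so it cannot change the sign of the sum.

  The same induction bounds the growth: each step multiplies the largest signed divided difference
  by at most \<open>2 / h\<close>, where \<open>h\<close> is a lower bound of the cell sizes near \<open>x i\<close>. With the weights
  bounded by powers of the length \<open>L\<close> of the \<open>2 * p\<close> cells around \<open>x i\<close>, the jump is at most
  \<open>p * 2 ^ (p - 1) * (L / h) ^ p\<close> times the jump of the averages (\<open>eno_jump_bounds\<close>). The quotient
  \<open>L / h\<close> is invariant under scaling, so it can be bounded by the mesh ratios alone
  (\<open>window_ratio_ge\<close>).
\<close>

section \<open>Stencils of neighbouring cells\<close>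

definition stencil_start :: "(int \<Rightarrow> real) \<Rightarrow> (int \<Rightarrow> real) \<Rightarrow> int \<Rightarrow> nat \<Rightarrow> int" where
  "stencil_start x V i j = i + eno_offset x V i j"

lemma stencil_start_1: "stencil_start x V i (Suc 0) = i - 1"
  by (simp add: stencil_start_def Let_def)

lemma stencil_start_Suc:
  assumes "1 \<le> j"
  shows "stencil_start x V i (Suc j) =
    (let s = stencil_start x V i j in
     if \<bar>divdiff x V (s - 1) (Suc j)\<bar> < \<bar>divdiff x V s (Suc j)\<bar> then s - 1 else s)"
  using assms by (simp add: stencil_start_def Let_def add.assoc del: divdiff.simps)

lemma stencil_start_bounds:
  assumes "1 \<le> j"
  shows "stencil_start x V i j \<in> {i - int j..i - 1}"
  using assms
proof (induction j rule: dec_induct)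
  case base
  show ?case by (simp add: stencil_start_1)
next
  case (step j)
  then show ?case by (auto simp: stencil_start_Suc Let_def simp del: divdiff.simps)
qed

text \<open>
  The stencil starts never cross: an order step moves each of them by at most one to the left,
  and once they coincide both cells make the same choices.
\<close>

lemma stencil_start_mono_cell:
  assumes "1 \<le> j"
  shows "stencil_start x V i j \<le> stencil_start x V (i + 1) j"
  using assms
proof (induction j rule: dec_induct)
  case base
  show ?case by (simp add: stencil_start_1)
next
  case (step j)
  show ?case
  proof (cases "stencil_start x V i j = stencil_start x V (i + 1) j")
    case True
    then show ?thesis using step.hyps(1) by (simp add: stencil_start_Suc)
  next
    case False
    then show ?thesis using step.IH step.hyps(1) by (simp add: stencil_start_Suc Let_def)
  qed
qed

section \<open>Sign alternation of the divided differences\<close>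

text \<open>
  The sign is that of the weight with which the divided difference enters the jump at \<open>x i\<close>; it
  is positive for the initial pair of stencils, where \<open>j = 1\<close> and \<open>k = i - 1\<close>.
\<close>

definition signed_divdiff ::
  "(int \<Rightarrow> real) \<Rightarrow> (int \<Rightarrow> real) \<Rightarrow> int \<Rightarrow> nat \<Rightarrow> int \<Rightarrow> real" where
  "signed_divdiff x V i j k = (-1) powi (k + int j - i) * divdiff x V k (Suc j)"

lemma abs_signed_divdiff: "\<bar>signed_divdiff x V i j k\<bar> = \<bar>divdiff x V k (Suc j)\<bar>"
  by (simp add: signed_divdiff_def abs_mult power_int_abs del: divdiff.simps)

text \<open>
  The alternating sign turns the difference in the recursion of the divided differences into a sum,
  so that terms of one sign reinforce each other.
\<close>

lemma signed_divdiff_Suc: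
  "signed_divdiff x V i (Suc j) k =
     (signed_divdiff x V i j (k + 1) + signed_divdiff x V i j k) / (x (k + int j + 2) - x k)"
proof -
  have *: "(-1 :: real) powi (k + 1 + int j - i) = - ((-1) powi (k + int j - i))"
    using power_int_add_1[of "-1::real" "k + int j - i"] by (simp add: algebra_simps)
  have **: "k + int (Suc j) - i = k + 1 + int j - i" by simp
  have pt: "k + int (Suc (Suc j)) = k + int j + 2" by simp
  have "divdiff x V k (Suc (Suc j)) =
      (divdiff x V (k + 1) (Suc j) - divdiff x V k (Suc j)) / (x (k + int j + 2) - x k)"
    by (subst divdiff.simps(2)) (simp only: pt)
  show ?thesis unfolding signed_divdiff_def ** * \<open>divdiff x V k (Suc (Suc j)) = _\<close>
    by (simp add: algebra_simps diff_divide_distrib del: divdiff.simps)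
qed

text \<open>
  The factor \<open>\<sigma> = \<plusminus>1\<close> treats increasing and decreasing averages at once; equal averages are covered
  by either choice. The lower and the upper bound are proved together, since in the induction step
  both follow from the same comparison of two neighbouring terms.
\<close>

lemma signed_divdiff_bounds:
  assumes h: "0 < h" "\<And>k j. 1 \<le> j \<Longrightarrow> j < p \<Longrightarrow> i - int (Suc j) \<le> k \<Longrightarrow> k < i \<Longrightarrow> h \<le> x (k + int j + 2) - x k"
    and \<sigma>: "\<bar>\<sigma>\<bar> = 1" and D: "0 \<le> \<sigma> * divdiff x V (i - 1) 2"
    and j: "1 \<le> j" "j \<le> p"
    and k: "stencil_start x V i j \<le> k" "k < stencil_start x V (i + 1) j"
  shows "\<sigma> * signed_divdiff x V i j k \<in> {0..(2 / h) ^ (j - 1) * (\<sigma> * divdiff x V (i - 1) 2)}"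
  using j k
proof (induction j arbitrary: k rule: dec_induct)
  case base
  then have "k = i - 1" by (simp add: stencil_start_1)
  then show ?case using D by (simp add: signed_divdiff_def numeral_2_eq_2 del: divdiff.simps)
next
  case (step j)
  define M where "M = (2 / h) ^ (j - 1) * (\<sigma> * divdiff x V (i - 1) 2)"
  define E where "E k = \<sigma> * signed_divdiff x V i j k" for k
  define a where "a = stencil_start x V i j"
  define b where "b = stencil_start x V (i + 1) j"
  have IH: "0 \<le> E k \<and> E k \<le> M" if "a \<le> k" "k < b" for k
    using step.IH[of k] step.prems that unfolding E_def M_def a_def b_def by simp
  have Eabs: "\<bar>E k\<bar> = \<bar>divdiff x V k (Suc j)\<bar>" for k
    using \<sigma> abs_signed_divdiff by (simp add: E_def abs_mult)
  have a': "stencil_start x V i (Suc j) = (if \<bar>E (a - 1)\<bar> < \<bar>E a\<bar> then a - 1 else a)"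
    using stencil_start_Suc[OF step.hyps(1), of x V i] by (simp only: Eabs a_def Let_def)
  have b': "stencil_start x V (i + 1) (Suc j) = (if \<bar>E (b - 1)\<bar> < \<bar>E b\<bar> then b - 1 else b)"
    using stencil_start_Suc[OF step.hyps(1), of x V "i + 1"] by (simp only: Eabs b_def Let_def)
  have ab: "a \<le> b"
    unfolding a_def b_def by (rule stencil_start_mono_cell[OF step.hyps(1)])
  \<comment> \<open>Equal stencils stay equal, but \<open>k\<close> lies between the new ones.\<close>
  have ne: "a < b"
  proof (rule ccontr)
    assume "\<not> a < b"
    then have "a = b" using ab by simp
    then show False using step.prems(2,3) unfolding a' b' by (auto split: if_splits)
  qed
  have sum: "0 \<le> E (k + 1) + E k \<and> E (k + 1) + E k \<le> 2 * M"
  proof -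
    \<comment> \<open>The new range of \<open>k\<close> reaches \<open>a - 1\<close> only if the left stencil was extended to the left, and
      \<open>b - 1\<close> only if the right stencil was not: this is where the ENO choice enters.\<close>
    consider "a \<le> k" "k + 1 < b" | "k = a - 1" "\<bar>E k\<bar> < \<bar>E (k + 1)\<bar>" | "k = b - 1" "\<bar>E (k + 1)\<bar> \<le> \<bar>E k\<bar>"
      using step.prems(2,3) unfolding a' b' by (force split: if_splits)
    then show ?thesis
    proof cases
      case 1
      then show ?thesis using IH[of k] IH[of "k + 1"] by linarith
    next
      case 2
      then show ?thesis using IH[of "k + 1"] ne by auto
    next
      case 3
      then show ?thesis using IH[of k] ne by auto
    qed
  qed
  have "h \<le> x (k + int j + 2) - x k"
    using h(2)[of j k] step stencil_start_bounds[of "Suc j" x V i]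
      stencil_start_bounds[of "Suc j" x V "i + 1"] by simp
  then have "(E (k + 1) + E k) / (x (k + int j + 2) - x k) \<le> 2 * M / h"
    using sum h by (intro frac_le) auto
  moreover have "0 \<le> (E (k + 1) + E k) / (x (k + int j + 2) - x k)"
    using sum \<open>h \<le> _\<close> h by simp
  moreover have "2 * M / h = (2 / h) ^ (Suc j - 1) * (\<sigma> * divdiff x V (i - 1) 2)"
    using step.hyps(1) by (cases j) (simp_all add: M_def)
  moreover have "\<sigma> * signed_divdiff x V i (Suc j) k = (E (k + 1) + E k) / (x (k + int j + 2) - x k)"
    by (simp add: signed_divdiff_Suc E_def algebra_simps)
  ultimately show ?case by simp
qed

section \<open>Newton interpolation\<close>

lemma interp_poly:
  assumes "strict_mono x"
  shows degree_interp_poly: "degree (interp_poly x V k p) \<le> p"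
    and poly_interp_poly: "m \<le> p \<Longrightarrow> poly (interp_poly x V k p) (x (k + int m)) = V (k + int m)"
  using theI'[OF interp_poly_unique_exists[OF assms, of p k V], folded interp_poly_def] by auto

lemma interp_poly_eqI:
  assumes "strict_mono x" "degree F \<le> p" "\<And>m. m \<le> p \<Longrightarrow> poly F (x (k + int m)) = V (k + int m)"
  shows "interp_poly x V k p = F"
  using interp_poly_unique_exists[OF assms(1), of p k V] degree_interp_poly[OF assms(1), of V k p]
    poly_interp_poly[OF assms(1), of _ p V k] assms(2,3)
  by blast

text \<open>
  Neville's recursion. It lives on the same pair of stencils as the recursion of \<open>divdiff\<close>, which
  makes the identification of the leading coefficient an immediate induction.
\<close>

lemma interp_poly_neville:
  assumes "strict_mono x"
  shows "smult (x (k + int (Suc p)) - x k) (interp_poly x V k (Suc p)) =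
    [:- x k, 1:] * interp_poly x V (k + 1) p -
    [:- x (k + int (Suc p)), 1:] * interp_poly x V k p" (is "smult ?d _ = ?N")
proof -
  have d: "?d \<noteq> 0" using assms by (simp add: strict_mono_eq)
  have "interp_poly x V k (Suc p) = smult (1 / ?d) ?N"
  proof (rule interp_poly_eqI[OF assms])
    have "degree ?N \<le> Suc p"
      using degree_mult_le[of "[:- x k, 1:]" "interp_poly x V (k + 1) p"]
        degree_mult_le[of "[:- x (k + int (Suc p)), 1:]" "interp_poly x V k p"]
        degree_interp_poly[OF assms, of V k p] degree_interp_poly[OF assms, of V "k + 1" p]
      by (intro degree_diff_le) auto
    then show "degree (smult (1 / ?d) ?N) \<le> Suc p"
      by (rule order.trans[OF degree_smult_le])
  next
    fix m assume m: "m \<le> Suc p"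
    have right: "poly (interp_poly x V (k + 1) p) (x (k + int m)) = V (k + int m)" if "0 < m"
      using poly_interp_poly[OF assms, of "m - 1" p V "k + 1"] that m by (simp add: of_nat_diff)
    have left: "poly (interp_poly x V k p) (x (k + int m)) = V (k + int m)" if "m \<le> p"
      using poly_interp_poly[OF assms that] .
    have "poly ?N (x (k + int m)) = ?d * V (k + int m)"
    proof -
      consider "m = 0" | "m = Suc p" | "0 < m" "m \<le> p" using m by linarith
      then show ?thesis
      proof cases
        case 1 then show ?thesis using left by (simp add: algebra_simps)
      next
        case 2 then show ?thesis using right by (simp add: algebra_simps)
      next
        case 3 then show ?thesis using left right by (simp add: algebra_simps)
      qed
    qed
    then show "poly (smult (1 / ?d) ?N) (x (k + int m)) = V (k + int m)"
      using d by simp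
  qed
  then show ?thesis using d by simp
qed

lemma coeff_interp_poly:
  assumes "strict_mono x"
  shows "coeff (interp_poly x V k p) p = divdiff x V k p"
proof (induction p arbitrary: k)
  case 0
  have "interp_poly x V k 0 = [:V k:]"
    by (rule interp_poly_eqI[OF assms]) auto
  then show ?case by simp
next
  case (Suc p)
  have c: "coeff (interp_poly x V k p) (Suc p) = 0" for k
    using degree_interp_poly[OF assms, of V k p] by (intro coeff_eq_0) simp
  have "(x (k + int (Suc p)) - x k) * coeff (interp_poly x V k (Suc p)) (Suc p) =
      divdiff x V (k + 1) p - divdiff x V k p"
    using arg_cong[OF interp_poly_neville[OF assms, of k p V], of "\<lambda>F. coeff F (Suc p)"]
    by (simp add: c Suc.IH)
  moreover have "x (k + int (Suc p)) - x k \<noteq> 0" using assms by (simp add: strict_mono_eq)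
  ultimately show ?case by (simp add: field_simps)
qed

text \<open>
  Newton's formula for shifting the stencil by one: both sides agree at the \<open>p\<close> common points and have
  the same coefficient of degree \<open>p\<close>, which together determine a polynomial of degree at most \<open>p\<close>.
\<close>

lemma interp_poly_shift:
  assumes "strict_mono x"
  shows "interp_poly x V (k + 1) p = interp_poly x V k p +
    smult (divdiff x V k (Suc p) * (x (k + int p + 1) - x k))
      (\<Prod>m\<in>{k<..k + int p}. [:- x m, 1:])" (is "_ = _ + smult ?c ?w")
proof (rule poly_eqI_degree_lead_coeff[where n = p and A = "x ` {k<..k + int p}"])
  have inj: "inj_on x A" for A using strict_mono_imp_inj_on[OF assms] inj_on_subset by blast
  have dw: "degree ?w = p" by (subst degree_prod_eq_sum_degree) auto
  have cw: "coeff ?w p = 1"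
    using lead_coeff_prod[of "\<lambda>m. [:- x m, 1:]" "{k<..k + int p}"] dw by simp
  show "p \<le> card (x ` {k<..k + int p})" by (simp add: card_image[OF inj])
  show "degree (interp_poly x V (k + 1) p) \<le> p" by (rule degree_interp_poly[OF assms])
  show "degree (interp_poly x V k p + smult ?c ?w) \<le> p"
    using dw by (intro degree_add_le degree_interp_poly[OF assms]
      order.trans[OF degree_smult_le]) simp
  have "x (k + int p + 1) - x k \<noteq> 0" using assms by (simp add: strict_mono_eq)
  then have "?c = divdiff x V (k + 1) p - divdiff x V k p"
    by (simp add: add_ac)
  then show "coeff (interp_poly x V (k + 1) p) p = coeff (interp_poly x V k p + smult ?c ?w) p"
    by (simp add: coeff_interp_poly[OF assms] cw del: divdiff.simps)
next
  fix z assume "z \<in> x ` {k<..k + int p}"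
  then obtain m where m: "k < m" "m \<le> k + int p" and z: "z = x m" by auto
  have "poly ?w z = 0" using m by (auto simp: z poly_prod)
  moreover have "poly (interp_poly x V k p) z = V m"
    using poly_interp_poly[OF assms, of "nat (m - k)" p V k] m by (simp add: z)
  moreover have "poly (interp_poly x V (k + 1) p) z = V m"
    using poly_interp_poly[OF assms, of "nat (m - k - 1)" p V "k + 1"] m by (simp add: z)
  ultimately show "poly (interp_poly x V (k + 1) p) z = poly (interp_poly x V k p + smult ?c ?w) z"
    by simp
qed

text \<open>
  At a root of the node polynomial only the term in which its own factor is differentiated survives;
  each of the \<open>k + p - i\<close> points to the right of \<open>x i\<close> contributes a factor \<open>-1\<close> to the sign.
\<close>

lemma pderiv_node_poly:
  fixes x :: "int \<Rightarrow> real"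
  assumes "strict_mono x" "k < i" "i \<le> k + int p"
  shows "poly (pderiv (\<Prod>m\<in>{k<..k + int p}. [:- x m, 1:])) (x i) =
    (-1) powi (k + int p - i) * (\<Prod>m\<in>{k<..k + int p} - {i}. \<bar>x i - x m\<bar>)"
proof -
  define S where "S = {k<..k + int p}"
  have "i \<in> S" "finite S" using assms by (auto simp: S_def)
  then have "(\<Prod>m\<in>S. [:- x m, 1:]) = [:- x i, 1:] * (\<Prod>m\<in>S - {i}. [:- x m, 1:])"
    by (rule prod.remove[rotated])
  then have "poly (pderiv (\<Prod>m\<in>S. [:- x m, 1:])) (x i) = (\<Prod>m\<in>S - {i}. x i - x m)"
    by (simp only: pderiv_mult) (simp add: pderiv_pCons poly_prod)
  also have "\<dots> = (\<Prod>m\<in>S - {i}. (if i < m then -1 else 1) * \<bar>x i - x m\<bar>)"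
    by (intro prod.cong refl) (simp add: abs_if strict_mono_less[OF assms(1)])
  also have "\<dots> = (\<Prod>m\<in>S - {i}. if i < m then -1 else 1) * (\<Prod>m\<in>S - {i}. \<bar>x i - x m\<bar>)"
    by (rule prod.distrib)
  also have "(\<Prod>m\<in>S - {i}. if i < m then -1 else (1::real)) = (\<Prod>m\<in>{i<..k + int p}. -1)"
    using assms(2,3) by (intro prod.mono_neutral_cong_right) (auto simp: S_def)
  also have "\<dots> = (-1) powi (k + int p - i)"
    using assms(3) by (simp add: power_int_def)
  finally show ?thesis by (simp add: S_def)
qed

section \<open>The jump at an interface\<close>

lemma interp_deriv_diff:
  assumes x: "strict_mono x" and ab: "a \<le> b" and i: "b \<le> i" "i \<le> a + int p"
  shows "poly (pderiv (interp_poly x V b p)) (x i) - poly (pderiv (interp_poly x V a p)) (x i) =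
    (\<Sum>k\<in>{a..<b}. signed_divdiff x V i p k * (x (k + int p + 1) - x k) *
       (\<Prod>m\<in>{k<..k + int p} - {i}. \<bar>x i - x m\<bar>))"
  using ab i(1)
proof (induction b rule: int_ge_induct)
  case base
  show ?case by simp
next
  case (step b)
  have "{a..<b + 1} = insert b {a..<b}" using step by auto
  moreover have "b < i" "i \<le> b + int p" using step i by auto
  then have "poly (pderiv (interp_poly x V (b + 1) p)) (x i) =
      poly (pderiv (interp_poly x V b p)) (x i) + signed_divdiff x V i p b *
        (x (b + int p + 1) - x b) * (\<Prod>m\<in>{b<..b + int p} - {i}. \<bar>x i - x m\<bar>)"
    by (simp add: interp_poly_shift[OF x] pderiv_add pderiv_smult pderiv_node_poly[OF x]
      signed_divdiff_def del: divdiff.simps)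
  ultimately show ?case using step by simp
qed

lemma eno_jump_eq:
  assumes x: "strict_mono x" and p: "1 \<le> p"
  shows "eno_right p x V i - eno_left p x V i =
    (\<Sum>k\<in>{stencil_start x V i p..<stencil_start x V (i + 1) p}.
       signed_divdiff x V i p k * (x (k + int p + 1) - x k) *
       (\<Prod>m\<in>{k<..k + int p} - {i}. \<bar>x i - x m\<bar>))"
  using interp_deriv_diff[OF x stencil_start_mono_cell[OF p, of x V i], of i p V]
    stencil_start_bounds[OF p, of x V i] stencil_start_bounds[OF p, of x V "i + 1"]
  by (simp add: eno_right_def eno_left_def eno_poly_def stencil_start_def add.assoc)

text \<open>
  The first divided differences of a primitive are the cell averages, so the second one carries the
  jump of the averages.
\<close>

lemma divdiff_2_eq:
  assumes "strict_mono x" "is_primitive x vbar V"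
  shows "divdiff x V (i - 1) 2 = (vbar (i + 1) - vbar i) / (x (i + 1) - x (i - 1))"
proof -
  have "x i - x (i - 1) \<noteq> 0" "x (i + 1) - x i \<noteq> 0"
    using assms(1) by (simp_all add: strict_mono_eq)
  moreover have "V i - V (i - 1) = (x i - x (i - 1)) * vbar i"
    "V (i + 1) - V i = (x (i + 1) - x i) * vbar (i + 1)"
    using assms(2)[unfolded is_primitive_def cell_size_def, rule_format, of i]
      assms(2)[unfolded is_primitive_def cell_size_def, rule_format, of "i + 1"] by simp_all
  ultimately show ?thesis by (simp add: numeral_2_eq_2 add.commute)
qed

text \<open>
  There are at most \<open>p\<close> terms in the jump. Each has a weight of at most \<open>L ^ p\<close>, being a product of
  \<open>p\<close> distances, and a signed divided difference of at most \<open>(2 / h) ^ (p - 1)\<close> times the second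
  one; the latter supplies the remaining factor \<open>1 / h\<close>.
\<close>

lemma eno_jump_bounds:
  assumes x: "strict_mono x" and V: "is_primitive x vbar V" and p: "1 \<le> p"
    and \<sigma>: "\<bar>\<sigma>\<bar> = 1" "0 \<le> \<sigma> * (vbar (i + 1) - vbar i)"
    and h: "0 < h" "\<And>m. i - int p < m \<Longrightarrow> m \<le> i + int p \<Longrightarrow> h \<le> cell_size x m"
  defines "L \<equiv> x (i + int p) - x (i - int p)"
  shows "\<sigma> * (eno_right p x V i - eno_left p x V i) \<in>
    {0..real p * 2 ^ (p - 1) * (L / h) ^ p * (\<sigma> * (vbar (i + 1) - vbar i))}"
proof -
  define D where "D = \<sigma> * divdiff x V (i - 1) 2"
  define K where "K = {stencil_start x V i p..<stencil_start x V (i + 1) p}"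
  define w where "w k = (x (k + int p + 1) - x k) * (\<Prod>m\<in>{k<..k + int p} - {i}. \<bar>x i - x m\<bar>)" for k
  define \<Delta> where "\<Delta> = \<sigma> * (vbar (i + 1) - vbar i)"
  have mono: "x m \<le> x n" if "m \<le> n" for m n using x that by (simp add: strict_mono_less_eq)
  have wide: "h \<le> x n - x m" if "i - int p \<le> m" "m < n" "n \<le> i + int p" for m n
  proof -
    have "h \<le> x n - x (n - 1)" using h(2)[of n] that by (simp add: cell_size_def)
    then show ?thesis using mono[of m "n - 1"] that by simp
  qed
  have D_eq: "D = \<Delta> / (x (i + 1) - x (i - 1))"
    by (simp add: D_def \<Delta>_def divdiff_2_eq[OF x V] del: divdiff.simps)
  have wide1: "h \<le> x (i + 1) - x (i - 1)" using wide[of "i - 1" "i + 1"] p by simp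
  have D0: "0 \<le> D" using \<sigma>(2) wide1 h(1) by (simp add: D_eq \<Delta>_def)
  have D_le: "D \<le> \<Delta> / h"
    unfolding D_eq using wide1 h(1) \<sigma>(2) by (intro divide_left_mono) (auto simp: \<Delta>_def)
  have L0: "0 \<le> L" unfolding L_def using mono[of "i - int p" "i + int p"] by simp
  have K: "i - int p \<le> k" "k < i" if "k \<in> K" for k
    using that stencil_start_bounds[OF p, of x V i] stencil_start_bounds[OF p, of x V "i + 1"]
    by (auto simp: K_def)
  have w: "0 \<le> w k" "w k \<le> L ^ p" if "k \<in> K" for k
  proof -
    note kK = K[OF that]
    have "0 \<le> x (k + int p + 1) - x k" "x (k + int p + 1) - x k \<le> L"
      using mono[of k "k + int p + 1"] mono[of "k + int p + 1" "i + int p"] mono[of "i - int p" k] kK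
      by (auto simp: L_def)
    moreover have "(\<Prod>m\<in>{k<..k + int p} - {i}. \<bar>x i - x m\<bar>) \<le> (\<Prod>m\<in>{k<..k + int p} - {i}. L)"
    proof (rule prod_mono)
      fix m assume "m \<in> {k<..k + int p} - {i}"
      then show "0 \<le> \<bar>x i - x m\<bar> \<and> \<bar>x i - x m\<bar> \<le> L"
        using mono[of m "i + int p"] mono[of "i - int p" m] mono[of i "i + int p"]
          mono[of "i - int p" i] kK by (auto simp: L_def)
    qed
    moreover have "(\<Prod>m\<in>{k<..k + int p} - {i}. L) = L ^ (p - 1)"
      using kK p by (simp add: card_Diff_singleton)
    ultimately have "0 \<le> w k" "w k \<le> L * L ^ (p - 1)"
      unfolding w_def using L0 by (auto intro!: mult_mono mult_nonneg_nonneg prod_nonneg)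
    then show "0 \<le> w k" "w k \<le> L ^ p" using p by (simp_all flip: power_Suc)
  qed
  have E: "\<sigma> * signed_divdiff x V i p k \<in> {0..(2 / h) ^ (p - 1) * D}" if "k \<in> K" for k
    unfolding D_def
  proof (rule signed_divdiff_bounds[where p = p])
    fix k j assume "1 \<le> j" "j < p" "i - int (Suc j) \<le> k" "k < i"
    then show "h \<le> x (k + int j + 2) - x k" by (intro wide) auto
  qed (use h(1) \<sigma>(1) D0 p that in \<open>auto simp: K_def D_def simp del: divdiff.simps\<close>)
  have jump: "\<sigma> * (eno_right p x V i - eno_left p x V i) =
      (\<Sum>k\<in>K. (\<sigma> * signed_divdiff x V i p k) * w k)"
    by (simp add: eno_jump_eq[OF x p] K_def w_def sum_distrib_left mult.assoc)
  have "(\<Sum>k\<in>K. (\<sigma> * signed_divdiff x V i p k) * w k) \<le> (\<Sum>k\<in>K. ((2 / h) ^ (p - 1) * D) * L ^ p)"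
  proof (rule sum_mono)
    fix k assume "k \<in> K"
    with E[of k] w[of k] show "(\<sigma> * signed_divdiff x V i p k) * w k \<le> ((2 / h) ^ (p - 1) * D) * L ^ p"
      by (intro mult_mono[of _ "(2 / h) ^ (p - 1) * D"]) auto
  qed
  also have "\<dots> = real (card K) * (((2 / h) ^ (p - 1) * D) * L ^ p)" by simp
  also have "\<dots> \<le> real p * (((2 / h) ^ (p - 1) * (\<Delta> / h)) * L ^ p)"
  proof -
    have "card K \<le> p"
      using stencil_start_bounds[OF p, of x V i] stencil_start_bounds[OF p, of x V "i + 1"]
      by (auto simp: K_def nat_le_iff)
    then show ?thesis using D0 D_le L0 h(1) \<sigma>(2) by (intro mult_mono) (auto simp: \<Delta>_def)
  qed
  also have "\<dots> = real p * 2 ^ (p - 1) * (L / h) ^ p * \<Delta>"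
    using p by (cases p) (simp_all add: power_divide mult_ac)
  finally have "\<sigma> * (eno_right p x V i - eno_left p x V i) \<le> real p * 2 ^ (p - 1) * (L / h) ^ p * \<Delta>"
    by (simp only: jump)
  moreover have "0 \<le> \<sigma> * (eno_right p x V i - eno_left p x V i)"
  proof -
    have "0 \<le> (\<sigma> * signed_divdiff x V i p k) * w k" if "k \<in> K" for k
      using E[OF that] w(1)[OF that] by (intro mult_nonneg_nonneg[of "\<sigma> * signed_divdiff x V i p k"]) auto
    then show ?thesis unfolding jump by (rule sum_nonneg)
  qed
  ultimately show ?thesis by (simp add: \<Delta>_def)
qed

section \<open>A bound in terms of the mesh ratios\<close>

text \<open>
  For the mesh ratios around an interface, this telescoping product is the size of
  cell \<open>k\<close> relative to cell \<open>n\<close> (both counted from the interface). In \<open>window_ratio\<close> the reference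
  cell \<open>n\<close> is the leftmost one of the window, so that \<open>n \<le> k\<close> for all cells that occur there.
\<close>

definition rel_cell_size :: "int \<Rightarrow> (int \<Rightarrow> real) \<Rightarrow> int \<Rightarrow> real" where
  "rel_cell_size n \<rho> k = (\<Prod>m\<in>{n..<k}. \<rho> m)"

lemma cell_size_pos: "strict_mono x \<Longrightarrow> 0 < cell_size x m"
  by (simp add: cell_size_def strict_mono_less)

lemma rel_cell_size_mesh_ratios:
  assumes "strict_mono x" "n \<le> k"
  shows "rel_cell_size n (mesh_ratios x i) k = cell_size x (i + k) / cell_size x (i + n)"
  using assms(2)
proof (induction k rule: int_ge_induct)
  case base
  show ?case using cell_size_pos[OF assms(1), of "i + n"] by (simp add: rel_cell_size_def)
next
  case (step k)
  have "{n..<k + 1} = insert k {n..<k}" using step by auto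
  then show ?case using step cell_size_pos[OF assms(1), of "i + k"]
    by (simp add: rel_cell_size_def mesh_ratios_def add.assoc)
qed

lemma sum_cell_size:
  assumes "a \<le> b"
  shows "(\<Sum>m\<in>{a<..b}. cell_size x m) = x b - x a"
  using assms
proof (induction b rule: int_ge_induct)
  case base
  show ?case by simp
next
  case (step b)
  have "{a<..b + 1} = insert (b + 1) {a<..b}" using step by auto
  then show ?case using step by (simp add: cell_size_def)
qed

text \<open>
  The sum over \<open>k\<close> alone is the length of the window in units of cell \<open>l\<close>; summing over \<open>l\<close>
  as well dominates the largest of these quotients.
\<close>

definition window_ratio :: "nat \<Rightarrow> (int \<Rightarrow> real) \<Rightarrow> real" where
  "window_ratio p \<rho> = (\<Sum>l\<in>{- int p<..int p}. \<Sum>k\<in>{- int p<..int p}.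
     rel_cell_size (1 - int p) \<rho> k / rel_cell_size (1 - int p) \<rho> l)"

lemma window_ratio_ge:
  assumes x: "strict_mono x" and m: "i - int p < m" "m \<le> i + int p"
  shows "(x (i + int p) - x (i - int p)) / cell_size x m \<le> window_ratio p (mesh_ratios x i)"
proof -
  define W where "W = {- int p<..int p}"
  define L where "L = x (i + int p) - x (i - int p)"
  note pos = cell_size_pos[OF x]
  have L: "(\<Sum>k\<in>W. cell_size x (i + k)) = L"
  proof -
    have "(\<Sum>k\<in>W. cell_size x (i + k)) = (\<Sum>m\<in>{i - int p<..i + int p}. cell_size x m)"
      by (rule sum.reindex_bij_witness[of _ "\<lambda>m. m - i" "\<lambda>k. i + k"]) (auto simp: W_def)
    then show ?thesis by (simp add: sum_cell_size L_def)
  qed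
  have "rel_cell_size (1 - int p) (mesh_ratios x i) k / rel_cell_size (1 - int p) (mesh_ratios x i) l =
      cell_size x (i + k) / cell_size x (i + l)" if "k \<in> W" "l \<in> W" for k l
    using that pos[of "i + (1 - int p)"] by (simp add: rel_cell_size_mesh_ratios[OF x] W_def)
  then have "window_ratio p (mesh_ratios x i) =
      (\<Sum>l\<in>W. \<Sum>k\<in>W. cell_size x (i + k) / cell_size x (i + l))"
    unfolding window_ratio_def W_def[symmetric] by (intro sum.cong refl) auto
  also have "\<dots> = (\<Sum>l\<in>W. L / cell_size x (i + l))"
    by (simp add: L flip: sum_divide_distrib)
  also have "\<dots> \<ge> L / cell_size x (i + (m - i))"
  proof (rule member_le_sum)
    show "m - i \<in> W" using m by (auto simp: W_def)
    have "0 \<le> L" unfolding L[symmetric] using pos by (intro sum_nonneg less_imp_le)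
    then show "0 \<le> L / cell_size x (i + l)" if "l \<in> W - {m - i}" for l
      using pos[of "i + l"] by simp
  qed (simp add: W_def)
  finally show ?thesis by (simp add: L_def)
qed

text \<open>
  With \<open>h = L / window_ratio\<close> the quotient \<open>L / h\<close> in the previous bound becomes the window ratio.
\<close>

lemma eno_jump_bounds_ratios:
  assumes x: "strict_mono x" and V: "is_primitive x vbar V" and p: "1 \<le> p"
    and \<sigma>: "\<bar>\<sigma>\<bar> = 1" "0 \<le> \<sigma> * (vbar (i + 1) - vbar i)"
  shows "\<sigma> * (eno_right p x V i - eno_left p x V i) \<in>
    {0..real p * 2 ^ (p - 1) * window_ratio p (mesh_ratios x i) ^ p * (\<sigma> * (vbar (i + 1) - vbar i))}"
proof -
  define L where "L = x (i + int p) - x (i - int p)"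
  define R where "R = window_ratio p (mesh_ratios x i)"
  note pos = cell_size_pos[OF x]
  have L: "0 < L" using x p by (simp add: L_def strict_mono_less)
  have R: "L / cell_size x m \<le> R" if "i - int p < m" "m \<le> i + int p" for m
    unfolding L_def R_def using window_ratio_ge[OF x that] .
  have "0 < L / cell_size x i" using L pos by simp
  also have "\<dots> \<le> R" using R[of i] p by simp
  finally have R0: "0 < R" .
  have "L / R \<le> cell_size x m" if "i - int p < m" "m \<le> i + int p" for m
    using R[OF that] R0 pos[of m] by (simp add: field_simps)
  from eno_jump_bounds[OF x V p \<sigma> _ this] show ?thesis
    using L R0 by (simp flip: L_def R_def)
qed

section \<open>The sign property and the bound on the jump\<close>

theorem theorem1p1:
  fixes p :: nat
  assumes "p > 1"
  shows
    "(\<forall>(x :: int \<Rightarrow> real) (vbar :: int \<Rightarrow> real) (V :: int \<Rightarrow> real) (i :: int).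
        strict_mono x \<longrightarrow> is_primitive x vbar V \<longrightarrow>
          (vbar (i + 1) - vbar i \<ge> 0 \<longrightarrow> eno_right p x V i - eno_left p x V i \<ge> 0) \<and>
          (vbar (i + 1) - vbar i \<le> 0 \<longrightarrow> eno_right p x V i - eno_left p x V i \<le> 0) \<and>
          (vbar (i + 1) = vbar i \<longrightarrow> eno_right p x V i = eno_left p x V i)) \<and>
     (\<exists>C :: (int \<Rightarrow> real) \<Rightarrow> real.
        \<forall>(x :: int \<Rightarrow> real) (vbar :: int \<Rightarrow> real) (V :: int \<Rightarrow> real) (i :: int).
          strict_mono x \<longrightarrow> is_primitive x vbar V \<longrightarrow> vbar (i + 1) \<noteq> vbar i \<longrightarrow>
            0 \<le> (eno_right p x V i - eno_left p x V i) / (vbar (i + 1) - vbar i) \<and>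
            (eno_right p x V i - eno_left p x V i) / (vbar (i + 1) - vbar i)
              \<le> C (mesh_ratios x i))"
proof -
  have p: "1 \<le> p" using assms by simp
  let ?C = "\<lambda>\<rho>. real p * 2 ^ (p - 1) * window_ratio p \<rho> ^ p"
  have up: "eno_right p x V i - eno_left p x V i \<in> {0..?C (mesh_ratios x i) * (vbar (i + 1) - vbar i)}"
    if "strict_mono x" "is_primitive x vbar V" "0 \<le> vbar (i + 1) - vbar i" for x vbar V i
    using eno_jump_bounds_ratios[OF that(1,2) p, of 1 i] that(3) by simp
  have down: "- (eno_right p x V i - eno_left p x V i) \<in>
      {0..?C (mesh_ratios x i) * - (vbar (i + 1) - vbar i)}"
    if "strict_mono x" "is_primitive x vbar V" "vbar (i + 1) - vbar i \<le> 0" for x vbar V i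
    using eno_jump_bounds_ratios[OF that(1,2) p, of "-1" i] that(3) by simp
  show ?thesis
  proof (intro conjI exI[of _ ?C] allI impI)
    fix x vbar V :: "int \<Rightarrow> real" and i :: int
    assume xV: "strict_mono x" "is_primitive x vbar V"
    note up = up[OF xV, of i] and down = down[OF xV, of i]
    show "0 \<le> eno_right p x V i - eno_left p x V i" if "0 \<le> vbar (i + 1) - vbar i"
      using up[OF that] by simp
    show "eno_right p x V i - eno_left p x V i \<le> 0" if "vbar (i + 1) - vbar i \<le> 0"
      using down[OF that] by simp
    show "eno_right p x V i = eno_left p x V i" if "vbar (i + 1) = vbar i"
      using up down that by simp
    assume ne: "vbar (i + 1) \<noteq> vbar i"
    have "(eno_right p x V i - eno_left p x V i) / (vbar (i + 1) - vbar i) \<in> {0..?C (mesh_ratios x i)}"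
    proof (cases "0 < vbar (i + 1) - vbar i")
      case True
      then show ?thesis using up by (simp add: divide_le_eq)
    next
      case False
      then have "vbar (i + 1) - vbar i < 0" using ne by simp
      then show ?thesis using down by (simp add: neg_divide_le_eq zero_le_divide_iff right_diff_distrib)
    qed
    then show "0 \<le> (eno_right p x V i - eno_left p x V i) / (vbar (i + 1) - vbar i)"
      "(eno_right p x V i - eno_left p x V i) / (vbar (i + 1) - vbar i) \<le> ?C (mesh_ratios x i)"
      by simp_all
  qed
qed

end
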